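(* Let $\tau \ge 0$ and let $\mathbf{L}$ be a real symmetric positive semi-definite matrix with largest eigenvalue $\lambda_{\max} = 2$. Let $h_\tau(\lambda) = \exp(-\tau\lambda)$ for $\lambda \in [0,2]$, and let $p_K$ be the truncation at order $K$ of the (shifted) Chebyshev series of $h_\tau$, i.e. $$p_K(\lambda) = \tfrac12 c_0(\tau) + \sum_{k=1}^{K} c_k(\tau)\, T_k(\lambda-1), \qquad c_k(\tau) = \frac{2}{\pi}\int_0^{\pi} \cos(k\theta) \exp\bigl(-\tau(\cos\theta+1)\bigr)\,\mathrm{d}\theta,$$ where $K \geq 0$ is an integer with $K > \tau/2 - 1$. Then $$\|h_\tau - p_K\|_\infty \ \le\ 2\, e^{\frac{(\tau/2)^2}{K+2}-\tau}\, \frac{(\tau/2)^{K+1}}{K!\,(K+1-\tau/2)},$$ where $\|g\|_\infty := \sup_{\lambda\in[0,\lambda_{\max}]}|g(\lambda)|$.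
   Context: $T_k$ denotes the Chebyshev polynomial of the first kind of degree $k$, characterized by $T_k(\cos\theta)=\cos(k\theta)$. *)

theory Defs
  imports "HOL-Analysis.Analysis" "Jordan_Normal_Form.Char_Poly"
begin

definition symmetric_matrix :: "real mat \<Rightarrow> bool" where
  "symmetric_matrix A \<longleftrightarrow> square_mat A \<and> transpose_mat A = A"

definition positive_semidefinite :: "real mat \<Rightarrow> bool" where
  "positive_semidefinite A \<longleftrightarrow>
     square_mat A \<and> (\<forall>v \<in> carrier_vec (dim_row A). 0 \<le> scalar_prod v (mult_mat_vec A v))"

text \<open>A relation rather than a \<open>Max\<close>, so that nothing depends on the value of \<open>Max {}\<close>
  for the \<open>0 \<times> 0\<close> matrix, which has no eigenvalue.\<close>

definition is_largest_eigenvalue :: "real mat \<Rightarrow> real \<Rightarrow> bool" where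
  "is_largest_eigenvalue A m \<longleftrightarrow> eigenvalue A m \<and> (\<forall>k. eigenvalue A k \<longrightarrow> k \<le> m)"

definition chebyshev_T :: "nat \<Rightarrow> real poly" where
  "chebyshev_T k = (THE p. \<forall>\<theta>. poly p (cos \<theta>) = cos (real k * \<theta>))"

lemma chebyshev_ex:
  "\<exists>p :: real poly. degree p = k \<and> lead_coeff p > 0 \<and> (\<forall>\<theta>. poly p (cos \<theta>) = cos (real k * \<theta>))"
proof (induction k rule: less_induct)
  case (less k)
  consider "k = 0" | "k = 1" | n where "k = Suc (Suc n)"
    by (metis One_nat_def not0_implies_Suc)
  then show ?case
  proof cases
    case 1
    then show ?thesis by (intro exI[of _ 1]) auto
  next
    case 2
    then show ?thesis by (intro exI[of _ "[:0, 1:]"]) auto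
  next
    case 3
    obtain p where p: "degree p = n" "\<And>\<theta>. poly p (cos \<theta>) = cos (real n * \<theta>)"
      using less.IH[of n] 3 by auto
    obtain q where q: "degree q = Suc n" "lead_coeff q > 0"
        "\<And>\<theta>. poly q (cos \<theta>) = cos (real (Suc n) * \<theta>)"
      using less.IH[of "Suc n"] 3 by blast
    let ?s = "[:0, 2:] * q"
    let ?r = "?s - p"
    have qnz: "q \<noteq> 0" using q(1) by auto
    have ds: "degree ?s = Suc (Suc n)"
      using qnz q(1) by (subst degree_mult_eq) auto
    have p0: "coeff p (Suc (Suc n)) = 0"
      using p(1) by (intro coeff_eq_0) simp
    have s0: "coeff ?s (Suc (Suc n)) = 2 * lead_coeff q"
      using q(1) by simp
    have c: "coeff ?r (Suc (Suc n)) = 2 * lead_coeff q"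
      using p0 s0 by simp
    have dr: "degree ?r = Suc (Suc n)"
    proof (rule antisym)
      show "degree ?r \<le> Suc (Suc n)"
        using ds p(1) by (intro degree_diff_le) auto
      show "Suc (Suc n) \<le> degree ?r"
        using c q(2) qnz by (intro le_degree) simp
    qed
    have "poly ?r (cos \<theta>) = cos (real k * \<theta>)" for \<theta>
    proof -
      have "cos (real (Suc (Suc n)) * \<theta>) = cos (real (Suc n) * \<theta> + \<theta>)"
        by (simp add: algebra_simps)
      moreover have "cos (real n * \<theta>) = cos (real (Suc n) * \<theta> - \<theta>)"
        by (simp add: algebra_simps)
      ultimately have "cos (real (Suc (Suc n)) * \<theta>)
          = 2 * cos \<theta> * cos (real (Suc n) * \<theta>) - cos (real n * \<theta>)"
        by (simp only: cos_add cos_diff) simp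
      then show ?thesis using p(2) q(3) 3 by simp
    qed
    moreover have "lead_coeff ?r > 0" using dr c q(2) by simp
    ultimately show ?thesis using dr 3 by blast
  qed
qed

lemma chebyshev_unique:
  fixes p q :: "real poly"
  assumes "\<And>\<theta>. poly p (cos \<theta>) = cos (real k * \<theta>)" "\<And>\<theta>. poly q (cos \<theta>) = cos (real k * \<theta>)"
  shows "p = q"
proof (rule ccontr)
  assume "p \<noteq> q"
  then have "finite {x. poly (p - q) x = 0}" by (intro poly_roots_finite) simp
  moreover have "{-1..1} \<subseteq> {x. poly (p - q) x = 0}"
  proof
    fix x :: real assume "x \<in> {-1..1}"
    then have "cos (arccos x) = x" by simp
    then show "x \<in> {x. poly (p - q) x = 0}"
      using assms[of "arccos x"] by simp
  qed
  ultimately have "finite {-1..1::real}" by (rule rev_finite_subset)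
  then show False using infinite_Icc[of "-1::real" 1] by simp
qed

lemma chebyshev_T_props:
  "degree (chebyshev_T k) = k \<and> (\<forall>\<theta>. poly (chebyshev_T k) (cos \<theta>) = cos (real k * \<theta>))"
proof -
  obtain p :: "real poly" where p: "degree p = k" "\<forall>\<theta>. poly p (cos \<theta>) = cos (real k * \<theta>)"
    using chebyshev_ex[of k] by blast
  have "chebyshev_T k = p"
    unfolding chebyshev_T_def
  proof (rule the_equality)
    show "\<forall>\<theta>. poly p (cos \<theta>) = cos (real k * \<theta>)" by (rule p(2))
    show "q = p" if "\<forall>\<theta>. poly q (cos \<theta>) = cos (real k * \<theta>)" for q
      using that p(2) by (intro chebyshev_unique[of q k p]) auto
  qed
  then show ?thesis using p by simp
qed

lemma degree_chebyshev_T: "degree (chebyshev_T k) = k"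
  and poly_chebyshev_T_cos: "poly (chebyshev_T k) (cos \<theta>) = cos (real k * \<theta>)"
  using chebyshev_T_props by auto

definition heat_kernel :: "real \<Rightarrow> real \<Rightarrow> real" where
  "heat_kernel \<tau> x = exp (- \<tau> * x)"

definition cheb_coeff :: "real \<Rightarrow> nat \<Rightarrow> real" where
  "cheb_coeff \<tau> k =
     2 / pi * integral {0..pi} (\<lambda>\<theta>. cos (real k * \<theta>) * exp (- \<tau> * (cos \<theta> + 1)))"

definition cheb_trunc :: "real \<Rightarrow> nat \<Rightarrow> real \<Rightarrow> real" where
  "cheb_trunc \<tau> K x =
     1 / 2 * cheb_coeff \<tau> 0 + (\<Sum>k=1..K. cheb_coeff \<tau> k * poly (chebyshev_T k) (x - 1))"

definition sup_norm_on :: "real set \<Rightarrow> (real \<Rightarrow> real) \<Rightarrow> real" where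
  "sup_norm_on S g = (SUP x\<in>S. \<bar>g x\<bar>)"

text \<open>The real-valued supremum is only meaningful for a bounded function; here it is.\<close>

lemma bdd_above_cheb_error:
  "bdd_above ((\<lambda>x. \<bar>heat_kernel \<tau> x - cheb_trunc \<tau> K x\<bar>) ` {0..b})"
proof -
  have "continuous_on {0..b} (\<lambda>x. \<bar>heat_kernel \<tau> x - cheb_trunc \<tau> K x\<bar>)"
    unfolding heat_kernel_def cheb_trunc_def by (intro continuous_intros)
  then show ?thesis
    by (intro bounded_imp_bdd_above compact_imp_bounded compact_continuous_image) auto
qed

end

theory Submission
  imports Defs
begin

text \<open>
  With \<open>w = (z/2) e\<^sup>i\<^sup>\<theta>\<close> we have \<open>exp (z cos \<theta>) = exp w \<cdot> exp (cnj w)\<close>. Multiplying the two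
  exponential series and collecting the terms with the same power of \<open>e\<^sup>i\<^sup>\<theta>\<close> gives the Fourier
  expansion \<open>exp (z cos \<theta>) = I\<^sub>0(z) + 2 \<Sum>\<^sub>k I\<^sub>k(z) cos (k\<theta>)\<close>, with modified Bessel coefficients.
  It converges uniformly, so \<open>c\<^sub>k = 2 e\<^sup>-\<^sup>\<tau> I\<^sub>k(-\<tau>)\<close>, and the truncation error is at most
  \<open>2 e\<^sup>-\<^sup>\<tau> \<Sum>\<^sub>k\<^sub>>\<^sub>K \<bar>I\<^sub>k(-\<tau>)\<bar>\<close>. Since \<open>(m+k)! \<ge> k! (k+1)\<^sup>m\<close>, one has
  \<open>\<bar>I\<^sub>k(z)\<bar> \<le> \<bar>z/2\<bar>\<^sup>k / k! \<cdot> exp ((z/2)\<^sup>2 / (k+1))\<close>, and the tail is dominated by a geometric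
  series of ratio \<open>(\<tau>/2) / (K+1)\<close>.
\<close>

section \<open>Modified Bessel functions: power series and bounds\<close>

lemma fact_mult_power_le_fact: "fact k * (real k + 1) ^ m \<le> fact (m + k)"
proof (induction m)
  case (Suc m)
  have "fact k * (real k + 1) ^ Suc m = (real k + 1) * (fact k * (real k + 1) ^ m)"
    by simp
  also have "\<dots> \<le> (real (Suc (m + k))) * fact (m + k)"
    using Suc by (intro mult_mono) auto
  finally show ?case by simp
qed simp

text \<open>The modified Bessel function of the first kind of integer order. Its series converges
  absolutely for every real \<open>z\<close> by \<open>bessel_I_abs_summable\<close>, so the
  infinite sum is never a default value.\<close>

definition bessel_I :: "nat \<Rightarrow> real \<Rightarrow> real" where
  "bessel_I k z = (\<Sum>m. (z / 2) ^ (2 * m + k) / (fact m * fact (m + k)))"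

text \<open>The majorant is a constant times a term of the exponential series at
  \<open>(z / 2)\<^sup>2 / (k + 1)\<close>, so it sums in closed form. The absolute values allow
  negative \<open>z\<close>; the later use is at \<open>- \<tau>\<close>.\<close>

lemma bessel_I_term_bound:
  fixes z :: real
  shows "\<bar>(z / 2) ^ (2 * m + k) / (fact m * fact (m + k))\<bar>
     \<le> \<bar>z / 2\<bar> ^ k / fact k * (((z / 2)\<^sup>2 / (real k + 1)) ^ m / fact m)"
proof -
  have "\<bar>(z / 2) ^ (2 * m + k) / (fact m * fact (m + k))\<bar>
      = \<bar>z / 2\<bar> ^ k * ((z / 2)\<^sup>2) ^ m / (fact m * fact (m + k))"
  proof -
    have "\<bar>(z / 2) ^ (2 * m + k)\<bar> = \<bar>z / 2\<bar> ^ k * ((z / 2)\<^sup>2) ^ m"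
      by (subst add.commute) (simp only: power_add power_mult abs_mult power_abs power2_abs)
    then show ?thesis by (simp only: abs_divide abs_mult abs_of_nonneg[OF fact_ge_zero])
  qed
  also have "\<dots> \<le> \<bar>z / 2\<bar> ^ k * ((z / 2)\<^sup>2) ^ m / (fact m * (fact k * (real k + 1) ^ m))"
    by (intro divide_left_mono mult_left_mono fact_mult_power_le_fact) auto
  also have "\<dots> = \<bar>z / 2\<bar> ^ k / fact k * (((z / 2)\<^sup>2 / (real k + 1)) ^ m / fact m)"
    by (simp only: power_divide[of "(z / 2)\<^sup>2"] divide_divide_eq_left times_divide_times_eq mult_ac)
  finally show ?thesis .
qed

lemma exp_dominant_sums:
  "(\<lambda>m. c * (x ^ m / fact m)) sums (c * exp (x :: real))"
  using exp_converges[of x] by (intro sums_mult) (simp add: divide_inverse mult.commute)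

lemma bessel_I_abs_summable:
  fixes z :: real
  shows "summable (\<lambda>m. \<bar>(z / 2) ^ (2 * m + k) / (fact m * fact (m + k))\<bar>)"
proof (rule summable_comparison_test')
  show "summable (\<lambda>m. \<bar>z / 2\<bar> ^ k / fact k * (((z / 2)\<^sup>2 / (real k + 1)) ^ m / fact m))"
    by (rule sums_summable[OF exp_dominant_sums])
  show "norm \<bar>(z / 2) ^ (2 * m + k) / (fact m * fact (m + k))\<bar>
      \<le> \<bar>z / 2\<bar> ^ k / fact k * (((z / 2)\<^sup>2 / (real k + 1)) ^ m / fact m)" for m
    using bessel_I_term_bound[of z m k] by (simp only: real_norm_def abs_idempotent)
qed

text \<open>The unordered form is the one needed for the rows when the double series is
  rearranged.\<close>

lemma bessel_I_has_sum:
  "((\<lambda>m. (z / 2) ^ (2 * m + k) / (fact m * fact (m + k))) has_sum bessel_I k z) UNIV"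
  unfolding bessel_I_def
  by (rule norm_summable_imp_has_sum[OF _ summable_sums[OF summable_rabs_cancel[OF bessel_I_abs_summable]]])
    (use bessel_I_abs_summable in \<open>simp only: real_norm_def\<close>)

lemma abs_bessel_I_le:
  "\<bar>bessel_I k z\<bar> \<le> \<bar>z / 2\<bar> ^ k / fact k * exp ((z / 2)\<^sup>2 / (real k + 1))"
proof -
  have "\<bar>bessel_I k z\<bar> \<le> (\<Sum>m. \<bar>(z / 2) ^ (2 * m + k) / (fact m * fact (m + k))\<bar>)"
    unfolding bessel_I_def by (rule summable_rabs[OF bessel_I_abs_summable])
  also have "\<dots> \<le> (\<Sum>m. \<bar>z / 2\<bar> ^ k / fact k * (((z / 2)\<^sup>2 / (real k + 1)) ^ m / fact m))"
    by (intro suminf_le bessel_I_term_bound bessel_I_abs_summable sums_summable[OF exp_dominant_sums])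
  also have "\<dots> = \<bar>z / 2\<bar> ^ k / fact k * exp ((z / 2)\<^sup>2 / (real k + 1))"
    using sums_unique[OF exp_dominant_sums] by metis
  finally show ?thesis .
qed

lemma summable_abs_bessel_I: "summable (\<lambda>k. \<bar>bessel_I k z\<bar>)"
proof (rule summable_comparison_test')
  show "summable (\<lambda>k. exp ((z / 2)\<^sup>2) * (\<bar>z / 2\<bar> ^ k / fact k))"
    by (rule sums_summable[OF exp_dominant_sums])
  show "norm \<bar>bessel_I k z\<bar> \<le> exp ((z / 2)\<^sup>2) * (\<bar>z / 2\<bar> ^ k / fact k)" for k
  proof -
    \<comment> \<open>Replacing \<open>k + 1\<close> by 1 makes the exponential factor independent
      of \<open>k\<close>.\<close>
    have "(z / 2)\<^sup>2 / (real k + 1) \<le> (z / 2)\<^sup>2 / 1"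
      by (intro divide_left_mono) auto
    then have "\<bar>z / 2\<bar> ^ k / fact k * exp ((z / 2)\<^sup>2 / (real k + 1))
        \<le> \<bar>z / 2\<bar> ^ k / fact k * exp ((z / 2)\<^sup>2)"
      by (intro mult_left_mono) auto
    then show ?thesis using abs_bessel_I_le[of k z] by (simp add: mult.commute)
  qed
qed

section \<open>Cosine expansion of \<open>exp (z * cos \<theta>)\<close>\<close>

text \<open>The product is kept as an unordered sum over pairs, so that it can be regrouped freely.
  Summability follows from the same double series of norms, whose row sums are again an exponential
  series up to a constant.\<close>

lemma has_sum_exp_mult_exp:
  fixes x y :: complex
  shows "((\<lambda>(j, m). (x ^ j / fact j) * (y ^ m / fact m)) has_sum (exp x * exp y)) UNIV"
proof -
  have real_sum: "((\<lambda>j. norm x ^ j / fact j) has_sum exp (norm x)) UNIV" for x :: complex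
  proof (rule norm_summable_imp_has_sum)
    show "(\<lambda>j. norm x ^ j / fact j) sums exp (norm x)"
      using exp_dominant_sums[of 1 "norm x"] by simp
    then show "summable (\<lambda>j. norm (norm x ^ j / fact j))"
      by (simp add: sums_iff)
  qed
  have complex_sum: "((\<lambda>j. x ^ j / fact j) has_sum exp x) UNIV" for x :: complex
  proof (rule norm_summable_imp_has_sum)
    show "(\<lambda>j. x ^ j / fact j) sums exp x"
      using exp_converges[of x] by (simp add: scaleR_conv_of_real field_simps)
    show "summable (\<lambda>j. norm (x ^ j / fact j))"
      using has_sum_imp_sums[OF real_sum[of x]] by (simp add: norm_divide norm_power sums_iff)
  qed
  have "(\<lambda>(j, m). (norm x ^ j / fact j) * (norm y ^ m / fact m)) summable_on (UNIV \<times> UNIV)"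
  proof (rule summable_on_SigmaI)
    show "((\<lambda>m. case (j, m) of (j, m) \<Rightarrow> (norm x ^ j / fact j) * (norm y ^ m / fact m))
        has_sum (norm x ^ j / fact j) * exp (norm y)) UNIV" for j
      unfolding prod.case by (intro has_sum_cmult_right real_sum)
    show "(\<lambda>j. (norm x ^ j / fact j) * exp (norm y)) summable_on UNIV"
      using has_sum_cmult_left[OF real_sum] by (rule has_sum_imp_summable)
  qed auto
  then have "(\<lambda>(j, m). (x ^ j / fact j) * (y ^ m / fact m)) summable_on (UNIV \<times> UNIV)"
    using abs_summable_summable[of "\<lambda>(j, m). (x ^ j / fact j) * (y ^ m / fact m)" "UNIV \<times> UNIV"]
    by (simp add: case_prod_unfold norm_mult norm_divide norm_power)
  then have "((\<lambda>(j, m). (x ^ j / fact j) * (y ^ m / fact m)) has_sum (exp x * exp y)) (UNIV \<times> UNIV)"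
  proof (rule has_sum_SigmaI[rotated 2])
    show "((\<lambda>m. case (j, m) of (j, m) \<Rightarrow> (x ^ j / fact j) * (y ^ m / fact m))
        has_sum (x ^ j / fact j) * exp y) UNIV" for j
      unfolding prod.case by (intro has_sum_cmult_right complex_sum)
    show "((\<lambda>j. (x ^ j / fact j) * exp y) has_sum (exp x * exp y)) UNIV"
      by (intro has_sum_cmult_left complex_sum)
  qed
  then show ?thesis by simp
qed

lemma has_sum_exp_cos:
  "((\<lambda>(j, m). (z / 2) ^ (j + m) / (fact j * fact m) * cos ((real j - real m) * \<theta>))
     has_sum exp (z * cos \<theta>)) UNIV"
proof -
  define w where "w = of_real (z / 2) * cis \<theta>"
  have w_cnj: "cnj w = of_real (z / 2) * cis (- \<theta>)"
    by (simp add: w_def cis_cnj)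
  have "exp w * exp (cnj w) = of_real (exp (z * cos \<theta>))"
  proof -
    have "w + cnj w = of_real (z * cos \<theta>)"
      by (subst complex_add_cnj) (simp add: w_def)
    then show ?thesis by (simp only: exp_of_real flip: exp_add)
  qed
  moreover have "(w ^ j / fact j) * (cnj w ^ m / fact m)
      = of_real ((z / 2) ^ (j + m) / (fact j * fact m)) * cis ((real j - real m) * \<theta>)" for j m
  proof -
    have "cis ((real j - real m) * \<theta>) = cis (real j * \<theta>) * cis (real m * (- \<theta>))"
      by (simp add: cis_mult left_diff_distrib)
    then show ?thesis
      unfolding w_cnj unfolding w_def power_mult_distrib Complex.DeMoivre by (simp add: power_add)
  qed
  ultimately have "((\<lambda>(j, m). of_real ((z / 2) ^ (j + m) / (fact j * fact m)) * cis ((real j - real m) * \<theta>))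
      has_sum of_real (exp (z * cos \<theta>))) UNIV"
    using has_sum_exp_mult_exp[of w "cnj w"] by simp
  \<comment> \<open>The sum is already real, so taking real parts only turns \<open>cis\<close> into
    \<open>cos\<close>.\<close>
  from has_sum_Re[OF this] show ?thesis
    by (simp add: case_prod_unfold del: of_real_mult of_real_power of_real_divide)
qed

text \<open>The index pairs split into \<open>D\<close>, on and below the diagonal, and its strict
  mirror image \<open>U\<close>. Grouping by the difference of the indices yields the same series on
  both, except that \<open>U\<close> lacks the term of order 0. Hence
  \<open>sD = sU + bessel_I 0 z\<close>, while \<open>sD + sU\<close> is the exponential, which
  explains the half.\<close>

lemma bessel_I_cos_sums:
  "(\<lambda>k. bessel_I k z * cos (real k * \<theta>)) sums ((exp (z * cos \<theta>) + bessel_I 0 z) / 2)"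
proof -
  define G where
    "G = (\<lambda>(j, m). (z / 2) ^ (j + m) / (fact j * fact m) * cos ((real j - real m) * \<theta>))"
  define D where "D = {(j, m). (m::nat) \<le> j}"
  define U where "U = {(j, m). (j::nat) < m}"
  have G: "(G has_sum exp (z * cos \<theta>)) UNIV"
    using has_sum_exp_cos unfolding G_def .
  then have summable: "G summable_on A" for A
    by (rule summable_on_subset[OF has_sum_imp_summable]) simp
  obtain sD sU where sD: "(G has_sum sD) D" and sU: "(G has_sum sU) U"
    using summable unfolding summable_on_def by metis
  have "D \<inter> U = {}" "D \<union> U = UNIV"
    by (auto simp: D_def U_def)
  then have split: "exp (z * cos \<theta>) = sD + sU"
    using has_sum_Un_disjoint[OF sD sU] G has_sum_unique by metis
  have row: "((\<lambda>m. (z / 2) ^ (2 * m + k) / (fact m * fact (m + k)) * cos (real k * \<theta>))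
      has_sum bessel_I k z * cos (real k * \<theta>)) UNIV" for k
    by (intro has_sum_cmult_left bessel_I_has_sum)
  have "((\<lambda>(k, m). (z / 2) ^ (2 * m + k) / (fact m * fact (m + k)) * cos (real k * \<theta>))
      has_sum sD) (UNIV \<times> UNIV)"
  proof (rule has_sum_reindex_bij_witness[where i = "\<lambda>(j, m). (j - m, m)"
          and j = "\<lambda>(k, m). (m + k, m)" and T = D and h = G, THEN iffD2, OF _ _ _ _ _ _ sD])
    fix a :: "nat \<times> nat"
    obtain k m where a: "a = (k, m)" by fastforce
    have "real (m + k) - real m = real k" "m + k + m = 2 * m + k"
      "fact (m + k) * fact m = fact m * (fact (m + k) :: real)"
      by simp_all
    then show "G (case a of (k, m) \<Rightarrow> (m + k, m)) =
        (case a of (k, m) \<Rightarrow> (z / 2) ^ (2 * m + k) / (fact m * fact (m + k)) * cos (real k * \<theta>))"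
      unfolding a G_def prod.case by metis
  qed (auto simp: D_def)
  then have D_sums: "((\<lambda>k. bessel_I k z * cos (real k * \<theta>)) has_sum sD) UNIV"
    by (rule has_sum_SigmaD) (simp only: row prod.case)
  \<comment> \<open>Above the diagonal the difference is at least 1, hence \<open>Suc k\<close>; its
    sign disappears because cosine is even.\<close>
  have "((\<lambda>(k, m). (z / 2) ^ (2 * m + Suc k) / (fact m * fact (m + Suc k)) * cos (real (Suc k) * \<theta>))
      has_sum sU) (UNIV \<times> UNIV)"
  proof (rule has_sum_reindex_bij_witness[where i = "\<lambda>(j, m). (m - Suc j, j)"
          and j = "\<lambda>(k, m). (m, m + Suc k)" and T = U and h = G, THEN iffD2, OF _ _ _ _ _ _ sU])
    fix a :: "nat \<times> nat"
    obtain k m where a: "a = (k, m)" by fastforce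
    have "(real m - real (m + Suc k)) * \<theta> = - (real (Suc k) * \<theta>)"
      by (simp add: algebra_simps)
    then have "cos ((real m - real (m + Suc k)) * \<theta>) = cos (real (Suc k) * \<theta>)"
      by (simp only: cos_minus)
    moreover have "m + (m + Suc k) = 2 * m + Suc k" by simp
    ultimately show "G (case a of (k, m) \<Rightarrow> (m, m + Suc k)) =
        (case a of (k, m) \<Rightarrow> (z / 2) ^ (2 * m + Suc k) / (fact m * fact (m + Suc k)) * cos (real (Suc k) * \<theta>))"
      unfolding a G_def prod.case by metis
  qed (auto simp: U_def)
  then have "((\<lambda>k. bessel_I (Suc k) z * cos (real (Suc k) * \<theta>)) has_sum sU) UNIV"
    by (rule has_sum_SigmaD) (simp only: row prod.case)
  then have "(\<lambda>k. bessel_I k z * cos (real k * \<theta>)) sums (sU + bessel_I 0 z)"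
    using sums_Suc_iff[of "\<lambda>k. bessel_I k z * cos (real k * \<theta>)" sU]
    by (auto dest: has_sum_imp_sums)
  moreover have "(\<lambda>k. bessel_I k z * cos (real k * \<theta>)) sums sD"
    using D_sums by (rule has_sum_imp_sums)
  ultimately have "sD = sU + bessel_I 0 z"
    by (rule sums_unique2[symmetric])
  then have "sD = (exp (z * cos \<theta>) + bessel_I 0 z) / 2"
    using split by simp
  then show ?thesis using D_sums has_sum_imp_sums by metis
qed

section \<open>Orthogonality of cosines and the Chebyshev coefficients\<close>

lemma has_integral_cos_nat:
  "((\<lambda>\<theta>. cos (real k * \<theta>)) has_integral (if k = 0 then pi else 0)) {0..pi}"
proof (cases "k = 0")
  case True
  then show ?thesis using has_integral_const_real[of "1::real" 0 pi] by simp
next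
  case False
  have "((\<lambda>\<theta>. cos (real k * \<theta>)) has_integral
      (sin (real k * pi) / real k - sin (real k * 0) / real k)) {0..pi}"
    using False
    by (intro fundamental_theorem_of_calculus)
      (auto intro!: derivative_eq_intros simp flip: has_real_derivative_iff_has_vector_derivative)
  then show ?thesis using False by simp
qed

lemma has_integral_cos_mult_cos:
  "((\<lambda>\<theta>. cos (real j * \<theta>) * cos (real k * \<theta>)) has_integral
     (if j = k then if k = 0 then pi else pi / 2 else 0)) {0..pi}"
\<comment> \<open>The product-to-sum formula involves \<open>k - j\<close>; assuming
  \<open>j \<le> k\<close> keeps this natural subtraction exact.\<close>
proof (induction j k rule: linorder_wlog)
  case (le j k)
  have "((\<lambda>\<theta>. (cos (real (k - j) * \<theta>) + cos (real (k + j) * \<theta>)) / 2) has_integral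
      ((if k - j = 0 then pi else 0) + (if k + j = 0 then pi else 0)) / 2) {0..pi}"
    by (intro has_integral_divide has_integral_add has_integral_cos_nat)
  moreover have "(cos (real (k - j) * \<theta>) + cos (real (k + j) * \<theta>)) / 2
      = cos (real j * \<theta>) * cos (real k * \<theta>)" for \<theta>
    using le by (simp add: of_nat_diff algebra_simps cos_add cos_diff)
  ultimately show ?case using le by (auto split: if_splits)
next
  case (sym j k)
  then show ?case by (cases "j = k") (simp_all add: mult.commute)
qed

text \<open>Uniform convergence permits integrating the cosine series term by term, and
  orthogonality leaves only the term \<open>j = k\<close>.\<close>

lemma integral_cos_exp_cos:
  "integral {0..pi} (\<lambda>\<theta>. cos (real k * \<theta>) * exp (z * cos \<theta>)) = pi * bessel_I k z"
proof -
  let ?f = "\<lambda>n \<theta>. \<Sum>j<n. bessel_I j z * (cos (real j * \<theta>) * cos (real k * \<theta>))"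
  let ?g = "\<lambda>\<theta>. (exp (z * cos \<theta>) + bessel_I 0 z) / 2 * cos (real k * \<theta>)"
  let ?c = "if k = 0 then pi else pi / 2"
  have pointwise: "(\<lambda>j. bessel_I j z * (cos (real j * \<theta>) * cos (real k * \<theta>))) sums ?g \<theta>" for \<theta>
    using sums_mult2[OF bessel_I_cos_sums] by (simp add: mult.assoc)
  have "uniform_limit {0..pi} ?f (\<lambda>\<theta>. \<Sum>j. bessel_I j z * (cos (real j * \<theta>) * cos (real k * \<theta>))) sequentially"
  proof (rule Weierstrass_m_test)
    show "norm (bessel_I j z * (cos (real j * \<theta>) * cos (real k * \<theta>))) \<le> \<bar>bessel_I j z\<bar>" for j \<theta>
      by (simp add: abs_mult mult_le_one mult_left_le)
  qed (rule summable_abs_bessel_I)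
  then have "uniform_limit {0..pi} ?f ?g sequentially"
    using sums_unique[OF pointwise] by simp
  then obtain I J where I: "\<And>n. (?f n has_integral I n) {0..pi}"
      and J: "(?g has_integral J) {0..pi}" and lim: "I \<longlonglongrightarrow> J"
    by (rule uniform_limit_integral) (auto intro!: continuous_intros)
  have "(?f n has_integral (\<Sum>j<n. bessel_I j z * (if j = k then ?c else 0))) {0..pi}" for n
    by (intro has_integral_sum has_integral_mult_right has_integral_cos_mult_cos) auto
  then have "I n = (\<Sum>j<n. bessel_I j z * (if j = k then ?c else 0))" for n
    using I has_integral_unique by blast
  then have "I n = bessel_I k z * ?c" if "k < n" for n
    using that by (simp add: if_distrib sum.delta cong: if_cong)
  then have "I \<longlonglongrightarrow> bessel_I k z * ?c"
    by (intro tendsto_eventually eventually_sequentiallyI[of "Suc k"]) auto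
  then have "J = bessel_I k z * ?c"
    using lim LIMSEQ_unique by blast
  \<comment> \<open>Doubling and subtracting undoes the averaging with \<open>bessel_I 0 z\<close>
    in \<open>?g\<close>. At \<open>k = 0\<close> the subtraction also reduces \<open>2 * pi\<close>
    to \<open>pi\<close>, so both cases of \<open>?c\<close> give one formula.\<close>
  then have "((\<lambda>\<theta>. 2 * ?g \<theta> - bessel_I 0 z * cos (real k * \<theta>)) has_integral
      2 * (bessel_I k z * ?c) - bessel_I 0 z * (if k = 0 then pi else 0)) {0..pi}"
    using J by (intro has_integral_diff has_integral_mult_right has_integral_cos_nat) auto
  moreover have "2 * ?g \<theta> - bessel_I 0 z * cos (real k * \<theta>) = cos (real k * \<theta>) * exp (z * cos \<theta>)" for \<theta>
    by (simp add: algebra_simps)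
  moreover have "2 * (bessel_I k z * ?c) - bessel_I 0 z * (if k = 0 then pi else 0) = pi * bessel_I k z"
    by simp
  ultimately have "((\<lambda>\<theta>. cos (real k * \<theta>) * exp (z * cos \<theta>)) has_integral pi * bessel_I k z) {0..pi}"
    by (simp only:)
  then show ?thesis by (rule integral_unique)
qed

lemma cheb_coeff_eq_bessel_I: "cheb_coeff \<tau> k = 2 * exp (- \<tau>) * bessel_I k (- \<tau>)"
proof -
  have "exp (- \<tau> * (cos \<theta> + 1)) = exp (- \<tau>) * exp (- \<tau> * cos \<theta>)" for \<theta>
    by (simp add: distrib_left flip: exp_add)
  then have "(\<lambda>\<theta>. cos (real k * \<theta>) * exp (- \<tau> * (cos \<theta> + 1)))
      = (\<lambda>\<theta>. exp (- \<tau>) * (cos (real k * \<theta>) * exp (- \<tau> * cos \<theta>)))"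
    by (simp only: mult.left_commute)
  then show ?thesis
    unfolding cheb_coeff_def using integral_cos_exp_cos[of k "- \<tau>"] by simp
qed

section \<open>The truncation error as a tail, and its geometric bound\<close>

lemma cheb_error_sums:
  "(\<lambda>i. 2 * exp (- \<tau>) * (bessel_I (i + Suc K) (- \<tau>) * cos (real (i + Suc K) * \<theta>)))
     sums (heat_kernel \<tau> (cos \<theta> + 1) - cheb_trunc \<tau> K (cos \<theta> + 1))"
proof -
  let ?t = "\<lambda>k. bessel_I k (- \<tau>) * cos (real k * \<theta>)"
  let ?s = "(exp (- \<tau> * cos \<theta>) + bessel_I 0 (- \<tau>)) / 2"
  have "(\<lambda>i. 2 * exp (- \<tau>) * ?t (i + Suc K)) sums (2 * exp (- \<tau>) * (?s - (\<Sum>k<Suc K. ?t k)))"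
    by (intro sums_mult sums_split_initial_segment bessel_I_cos_sums)
  moreover have "(\<Sum>k<Suc K. ?t k) = bessel_I 0 (- \<tau>) + (\<Sum>k=1..K. ?t k)"
    by (simp add: sum.lessThan_Suc_shift sum.atLeast1_atMost_eq del: sum.lessThan_Suc)
  moreover have "cheb_trunc \<tau> K (cos \<theta> + 1)
      = exp (- \<tau>) * bessel_I 0 (- \<tau>) + 2 * exp (- \<tau>) * (\<Sum>k=1..K. ?t k)"
    unfolding cheb_trunc_def cheb_coeff_eq_bessel_I
    by (simp add: poly_chebyshev_T_cos sum_distrib_left mult.assoc)
  moreover have "heat_kernel \<tau> (cos \<theta> + 1) = exp (- \<tau>) * exp (- \<tau> * cos \<theta>)"
    by (simp add: heat_kernel_def distrib_left flip: exp_add)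
  \<comment> \<open>Here \<open>e\<close> stands for \<open>exp (- \<tau>)\<close>, \<open>x\<close>
    for \<open>exp (- \<tau> * cos \<theta>)\<close>, \<open>b\<close> for the coefficient of order
    0 and \<open>S\<close> for the remaining partial sum.\<close>
  moreover have "2 * e * ((x + b) / 2 - (b + S)) = e * x - (e * b + 2 * e * S)" for e x b S :: real
    by (simp add: field_simps)
  ultimately show ?thesis by (simp only:)
qed

lemma exp_tail_term_le_geometric:
  fixes a :: real
  assumes "a \<ge> 0"
  shows "a ^ (i + Suc K) / fact (i + Suc K) \<le> a ^ Suc K / fact (Suc K) * (a / (real K + 1)) ^ i"
proof -
  \<comment> \<open>The factorial bound would give the ratio \<open>a / (K + 2)\<close>; weakening
    it to \<open>a / (K + 1)\<close> produces the factor \<open>K + 1 - \<tau> / 2\<close> of the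
    final estimate.\<close>
  have "fact (Suc K) * (real K + 1) ^ i \<le> fact (Suc K) * (real (Suc K) + 1) ^ i"
    by (intro mult_left_mono power_mono) auto
  also have "\<dots> \<le> fact (i + Suc K)"
    by (rule fact_mult_power_le_fact)
  finally have "a ^ (i + Suc K) / fact (i + Suc K) \<le> a ^ (i + Suc K) / (fact (Suc K) * (real K + 1) ^ i)"
    using assms by (intro divide_left_mono) (auto simp del: fact_Suc)
  then show ?thesis
    by (simp add: power_add power_divide mult_ac del: fact_Suc)
qed

lemma cheb_error_bound:
  assumes "\<tau> \<ge> 0" and "real K > \<tau> / 2 - 1"
  shows "\<bar>heat_kernel \<tau> (cos \<theta> + 1) - cheb_trunc \<tau> K (cos \<theta> + 1)\<bar>
    \<le> 2 * exp ((\<tau> / 2)\<^sup>2 / (real K + 2) - \<tau>)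
        * ((\<tau> / 2) ^ (K + 1) / (fact K * (real K + 1 - \<tau> / 2)))"
proof -
  define a where "a = \<tau> / 2"
  define q where "q = a / (real K + 1)"
  define M where "M = exp (a\<^sup>2 / (real K + 2))"
  let ?e = "\<lambda>i. 2 * exp (- \<tau>) * (bessel_I (i + Suc K) (- \<tau>) * cos (real (i + Suc K) * \<theta>))"
  let ?b = "\<lambda>i. 2 * exp (- \<tau>) * (M * (a ^ Suc K / fact (Suc K)) * q ^ i)"
  have a: "a \<ge> 0" "a < real K + 1"
    using assms by (auto simp: a_def)
  \<comment> \<open>The hypothesis \<open>K > \<tau> / 2 - 1\<close> is exactly what makes the
    geometric series converge.\<close>
  then have q: "0 \<le> q" "q < 1"
    by (auto simp: q_def)
  have term_le: "norm (?e i) \<le> ?b i" for i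
  proof -
    \<comment> \<open>The exponent is largest for the first omitted order \<open>K + 1\<close>,
      which is where \<open>K + 2\<close> comes from.\<close>
    have "a\<^sup>2 / (real (i + Suc K) + 1) \<le> a\<^sup>2 / (real K + 2)"
      by (intro divide_left_mono) auto
    then have "exp (a\<^sup>2 / (real (i + Suc K) + 1)) \<le> M"
      by (simp add: M_def)
    moreover have "\<bar>bessel_I (i + Suc K) (- \<tau>)\<bar>
        \<le> a ^ (i + Suc K) / fact (i + Suc K) * exp (a\<^sup>2 / (real (i + Suc K) + 1))"
      using abs_bessel_I_le[of "i + Suc K" "- \<tau>"] a(1) by (simp add: a_def)
    ultimately have "\<bar>bessel_I (i + Suc K) (- \<tau>)\<bar> \<le> a ^ Suc K / fact (Suc K) * q ^ i * M"
      using exp_tail_term_le_geometric[OF a(1), of i K] a(1) q(1) unfolding q_def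
      by (elim order.trans) (intro mult_mono; simp del: fact_Suc)
    moreover have "\<bar>bessel_I (i + Suc K) (- \<tau>) * cos (real (i + Suc K) * \<theta>)\<bar> \<le> \<bar>bessel_I (i + Suc K) (- \<tau>)\<bar>"
      using abs_cos_le_one by (simp add: abs_mult mult_left_le del: of_nat_add of_nat_Suc)
    ultimately have "\<bar>bessel_I (i + Suc K) (- \<tau>) * cos (real (i + Suc K) * \<theta>)\<bar>
        \<le> M * (a ^ Suc K / fact (Suc K)) * q ^ i"
      by (simp only: mult_ac)
    then show ?thesis
      unfolding real_norm_def abs_mult[of "2 * exp (- \<tau>)"] by (intro mult_mono) auto
  qed
  have b_sums: "?b sums (2 * exp (- \<tau>) * (M * (a ^ Suc K / fact (Suc K)) * (1 / (1 - q))))"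
    using q by (intro sums_mult geometric_sums) simp
  have "norm (suminf ?e) \<le> suminf ?b"
    using term_le b_sums by (intro norm_suminf_le) (auto simp: sums_iff)
  also have "\<dots> = 2 * exp (- \<tau>) * (M * (a ^ Suc K / fact (Suc K)) * (1 / (1 - q)))"
    using b_sums by (rule sums_unique[symmetric])
  also have "\<dots> = 2 * (exp (- \<tau>) * M) * (a ^ (K + 1) / (fact K * (real K + 1 - a)))"
  proof -
    \<comment> \<open>The factor \<open>K + 1\<close> of the factorial cancels the denominator of
      \<open>q\<close>.\<close>
    have "fact (Suc K) * (1 - q) = fact K * (real K + 1 - a)"
      by (simp add: q_def field_simps)
    then have "a ^ Suc K / fact (Suc K) * (1 / (1 - q)) = a ^ (K + 1) / (fact K * (real K + 1 - a))"
      by (simp del: fact_Suc)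
    then show ?thesis by (simp only: mult.assoc)
  qed
  also have "exp (- \<tau>) * M = exp (a\<^sup>2 / (real K + 2) - \<tau>)"
    by (simp add: M_def flip: exp_add)
  finally show ?thesis
    using sums_unique[OF cheb_error_sums] by (simp add: a_def)
qed

theorem mainTheorem2:
  fixes \<tau> lam_max :: real and n K :: nat and L :: "real mat"
  assumes "\<tau> \<ge> 0"
    and "L \<in> carrier_mat n n"
    and "symmetric_matrix L"
    and "positive_semidefinite L"
    and "is_largest_eigenvalue L lam_max"
    and "lam_max = 2"
    and "real K > \<tau> / 2 - 1"
  shows "sup_norm_on {0..lam_max} (\<lambda>x. heat_kernel \<tau> x - cheb_trunc \<tau> K x)
    \<le> 2 * exp ((\<tau> / 2)\<^sup>2 / (real K + 2) - \<tau>)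
        * ((\<tau> / 2) ^ (K + 1) / (fact K * (real K + 1 - \<tau> / 2)))"
  unfolding sup_norm_on_def
proof (rule cSUP_least)
  show "{0..lam_max} \<noteq> {}"
    using assms(6) by simp
  fix x assume "x \<in> {0..lam_max}"
  \<comment> \<open>Since \<open>x - 1\<close> lies between -1 and 1, the bound in terms of \<theta>
    covers every point of the interval.\<close>
  then have "x = cos (arccos (x - 1)) + 1"
    using assms(6) by simp
  then show "\<bar>heat_kernel \<tau> x - cheb_trunc \<tau> K x\<bar>
      \<le> 2 * exp ((\<tau> / 2)\<^sup>2 / (real K + 2) - \<tau>)
        * ((\<tau> / 2) ^ (K + 1) / (fact K * (real K + 1 - \<tau> / 2)))"
    using cheb_error_bound[OF assms(1,7), of "arccos (x - 1)"] by simp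
qed

end
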